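(* Let $\mathbb{G}(\Gamma_1)$ and $\mathbb{G}(\Gamma_2)$ be the partially commutative groups with presentations $$\mathbb{G}(\Gamma_1)=\langle a,b,c,d,e\mid [a,d],[a,e],[b,e],[c,d],[d,e]\rangle,$$ $$\mathbb{G}(\Gamma_2)=\langle a_1,a_2,b,c,d,e\mid [a_1,a_2],[a_1,c],[a_1,d],[a_1,e],[a_2,b],[a_2,d],[a_2,e],[b,e],[c,d],[d,e]\rangle.$$ Then the map $\varphi$ defined on generators by $a\mapsto a_1a_2$, $b\mapsto b$, $c\mapsto c$, $d\mapsto d$, $e\mapsto e$ extends to a monomorphism (injective group homomorphism) $\varphi:\mathbb{G}(\Gamma_1)\to\mathbb{G}(\Gamma_2)$.
   Context: For elements $g,h$ of a group, $[g,h]=g^{-1}h^{-1}gh$. For a simple undirected graph $\Gamma$ with vertex set $X$ and edge set $E$, the partially commutative group with commutation graph $\Gamma$ is $\mathbb{G}(\Gamma)=\langle X\mid [x,y],\ \{x,y\}\in E\rangle$. Here $\Gamma_1$ is the graph with vertices $a,b,c,d,e$ and edges $\{a,d\},\{a,e\},\{b,e\},\{c,d\},\{d,e\}$, and $\Gamma_2$ is the graph with vertices $a_1,a_2,b,c,d,e$ and edges $\{a_1,a_2\},\{a_1,c\},\{a_1,d\},\{a_1,e\},\{a_2,b\},\{a_2,d\},\{a_2,e\},\{b,e\},\{c,d\},\{d,e\}$. *)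

theory Defs
  imports "HOL-Algebra.Group"
begin

section \<open>Groups given by presentations\<close>

text \<open>A letter \<open>(x, True)\<close> stands for the generator \<open>x\<close> and \<open>(x, False)\<close> for its formal inverse.\<close>

type_synonym 'a word = "('a \<times> bool) list"

definition words :: "'a set \<Rightarrow> 'a word set" where
  "words X = lists (X \<times> UNIV)"

text \<open>Equality of words in \<open>\<langle>X | R\<rangle>\<close>: the equivalence relation on words over \<open>X\<close> generated by
  insertion and deletion, at any position, of trivial pairs \<open>x x\<^sup>-\<^sup>1\<close>, \<open>x\<^sup>-\<^sup>1 x\<close> and of relators.\<close>

inductive pres_eq :: "'a set \<Rightarrow> 'a word set \<Rightarrow> 'a word \<Rightarrow> 'a word \<Rightarrow> bool"
  for X :: "'a set" and R :: "'a word set" where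
  refl: "w \<in> words X \<Longrightarrow> pres_eq X R w w"
| sym: "pres_eq X R u v \<Longrightarrow> pres_eq X R v u"
| trans: "pres_eq X R u v \<Longrightarrow> pres_eq X R v w \<Longrightarrow> pres_eq X R u w"
| cancel: "u \<in> words X \<Longrightarrow> v \<in> words X \<Longrightarrow> x \<in> X \<Longrightarrow>
    pres_eq X R (u @ [(x, s), (x, \<not> s)] @ v) (u @ v)"
| relator: "u \<in> words X \<Longrightarrow> v \<in> words X \<Longrightarrow> r \<in> R \<Longrightarrow> r \<in> words X \<Longrightarrow>
    pres_eq X R (u @ r @ v) (u @ v)"

definition pres_rel :: "'a set \<Rightarrow> 'a word set \<Rightarrow> ('a word \<times> 'a word) set" where
  "pres_rel X R = {(u, v). pres_eq X R u v}"

definition pres_class :: "'a set \<Rightarrow> 'a word set \<Rightarrow> 'a word \<Rightarrow> 'a word set" where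
  "pres_class X R w = pres_rel X R `` {w}"

definition presented_group :: "'a set \<Rightarrow> 'a word set \<Rightarrow> 'a word set monoid" where
  "presented_group X R =
    \<lparr>carrier = words X // pres_rel X R,
     mult = (\<lambda>P Q. \<Union>u\<in>P. \<Union>v\<in>Q. pres_class X R (u @ v)),
     one = pres_class X R []\<rparr>"

definition pres_gen :: "'a set \<Rightarrow> 'a word set \<Rightarrow> 'a \<Rightarrow> 'a word set" where
  "pres_gen X R x = pres_class X R [(x, True)]"


section \<open>Partially commutative groups\<close>

text \<open>A graph is a pair of a vertex set and a set of edges, each edge a two-element set of vertices.\<close>

type_synonym 'a graph = "'a set \<times> 'a set set"

definition simple_graph :: "'a graph \<Rightarrow> bool" where
  "simple_graph \<Gamma> \<longleftrightarrow> (\<forall>e\<in>snd \<Gamma>. e \<subseteq> fst \<Gamma> \<and> card e = 2)"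

text \<open>The commutator convention is \<open>[x, y] = x\<^sup>-\<^sup>1 y\<^sup>-\<^sup>1 x y\<close>.\<close>

definition commutator_word :: "'a \<Rightarrow> 'a \<Rightarrow> 'a word" where
  "commutator_word x y = [(x, False), (y, False), (x, True), (y, True)]"

text \<open>As edges are unordered, both \<open>[x, y]\<close> and its inverse \<open>[y, x]\<close> occur for every edge
  \<open>{x, y}\<close>.\<close>

definition pc_relators :: "'a graph \<Rightarrow> 'a word set" where
  "pc_relators \<Gamma> = {commutator_word x y | x y. {x, y} \<in> snd \<Gamma>}"

definition pc_group :: "'a graph \<Rightarrow> 'a word set monoid" (\<open>\<G>\<close>) where
  "\<G> \<Gamma> = presented_group (fst \<Gamma>) (pc_relators \<Gamma>)"

definition pc_gen :: "'a graph \<Rightarrow> 'a \<Rightarrow> 'a word set" where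
  "pc_gen \<Gamma> x = pres_gen (fst \<Gamma>) (pc_relators \<Gamma>) x"


section \<open>The two commutation graphs\<close>

datatype vertex1 = A | B | C | D | E

datatype vertex2 = A1 | A2 | B | C | D | E

hide_const (open) vertex1.A vertex1.B vertex1.C vertex1.D vertex1.E
hide_const (open) vertex2.A1 vertex2.A2 vertex2.B vertex2.C vertex2.D vertex2.E

definition \<Gamma>\<^sub>1 :: "vertex1 graph" where
  "\<Gamma>\<^sub>1 = ({vertex1.A, vertex1.B, vertex1.C, vertex1.D, vertex1.E},
    {{vertex1.A, vertex1.D}, {vertex1.A, vertex1.E}, {vertex1.B, vertex1.E},
     {vertex1.C, vertex1.D}, {vertex1.D, vertex1.E}})"

definition \<Gamma>\<^sub>2 :: "vertex2 graph" where
  "\<Gamma>\<^sub>2 = ({vertex2.A1, vertex2.A2, vertex2.B, vertex2.C, vertex2.D, vertex2.E},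
    {{vertex2.A1, vertex2.A2}, {vertex2.A1, vertex2.C}, {vertex2.A1, vertex2.D},
     {vertex2.A1, vertex2.E}, {vertex2.A2, vertex2.B}, {vertex2.A2, vertex2.D},
     {vertex2.A2, vertex2.E}, {vertex2.B, vertex2.E}, {vertex2.C, vertex2.D},
     {vertex2.D, vertex2.E}})"

lemma simple_graph_\<Gamma>\<^sub>1: "simple_graph \<Gamma>\<^sub>1"
  by (simp add: simple_graph_def \<Gamma>\<^sub>1_def)

lemma simple_graph_\<Gamma>\<^sub>2: "simple_graph \<Gamma>\<^sub>2"
  by (simp add: simple_graph_def \<Gamma>\<^sub>2_def)


section \<open>Presented groups are groups with the expected universal property\<close>

lemma words_Nil [simp]: "[] \<in> words X"
  by (simp add: words_def)

lemma words_append [simp]: "u @ v \<in> words X \<longleftrightarrow> u \<in> words X \<and> v \<in> words X"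
  by (auto simp: words_def)

lemma words_Cons [simp]: "(x, s) # w \<in> words X \<longleftrightarrow> x \<in> X \<and> w \<in> words X"
  by (auto simp: words_def)

lemma pres_eq_words: "pres_eq X R u v \<Longrightarrow> u \<in> words X \<and> v \<in> words X"
  by (induction rule: pres_eq.induct) auto

lemma pres_eq_context:
  assumes "pres_eq X R u v" "p \<in> words X" "q \<in> words X"
  shows "pres_eq X R (p @ u @ q) (p @ v @ q)"
  using assms
proof (induction rule: pres_eq.induct)
  case (cancel u v x s)
  then show ?case
    using pres_eq.cancel[of "p @ u" X "v @ q" x R s] by simp
next
  case (relator u v r)
  then show ?case
    using pres_eq.relator[of "p @ u" X "v @ q" r R] by simp
next
  case (trans u v w)
  then show ?case
    by (metis pres_eq.trans)
qed (simp_all add: pres_eq.refl pres_eq.sym)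

lemma pres_eq_append:
  assumes "pres_eq X R u u'" "pres_eq X R v v'"
  shows "pres_eq X R (u @ v) (u' @ v')"
proof -
  have "pres_eq X R ([] @ u @ v) ([] @ u' @ v)"
    using assms pres_eq_words by (intro pres_eq_context) auto
  moreover have "pres_eq X R (u' @ v @ []) (u' @ v' @ [])"
    using assms pres_eq_words by (intro pres_eq_context) auto
  ultimately have "pres_eq X R (u @ v) (u' @ v)" "pres_eq X R (u' @ v) (u' @ v')"
    by simp_all
  then show ?thesis
    by (rule pres_eq.trans)
qed

lemma equiv_pres_rel: "equiv (words X) (pres_rel X R)"
proof (rule equivI)
  show "pres_rel X R \<subseteq> words X \<times> words X"
    using pres_eq_words by (force simp: pres_rel_def)
  show "refl_on (words X) (pres_rel X R)"
    by (rule refl_onI) (simp add: pres_rel_def pres_eq.refl)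
  show "sym (pres_rel X R)"
    by (rule symI) (simp add: pres_rel_def pres_eq.sym)
  show "trans (pres_rel X R)"
    by (rule transI, unfold pres_rel_def mem_Collect_eq case_prod_conv, rule pres_eq.trans)
qed

lemma pres_class_eq_iff:
  assumes "u \<in> words X" "v \<in> words X"
  shows "pres_class X R u = pres_class X R v \<longleftrightarrow> pres_eq X R u v"
  using eq_equiv_class_iff[OF equiv_pres_rel assms, of R]
  by (simp add: pres_class_def pres_rel_def)

lemma mem_pres_class: "v \<in> pres_class X R u \<longleftrightarrow> pres_eq X R u v"
  by (simp add: pres_class_def pres_rel_def)

lemma carrier_presented_group: "carrier (presented_group X R) = pres_class X R ` words X"
  by (auto simp: presented_group_def quotient_def pres_class_def)

lemma one_presented_group: "\<one>\<^bsub>presented_group X R\<^esub> = pres_class X R []"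
  by (simp add: presented_group_def)

lemma mult_presented_group:
  assumes "u \<in> words X" "v \<in> words X"
  shows "pres_class X R u \<otimes>\<^bsub>presented_group X R\<^esub> pres_class X R v = pres_class X R (u @ v)"
proof -
  have *: "pres_class X R (u' @ v') = pres_class X R (u @ v)"
    if "u' \<in> pres_class X R u" "v' \<in> pres_class X R v" for u' v'
  proof -
    have "pres_eq X R (u @ v) (u' @ v')"
      using that by (auto simp: mem_pres_class intro: pres_eq_append)
    then show ?thesis
      using pres_eq_words[of X R "u @ v" "u' @ v'"] by (simp add: pres_class_eq_iff pres_eq.sym)
  qed
  have "u \<in> pres_class X R u" "v \<in> pres_class X R v"
    using assms by (auto simp: mem_pres_class intro: pres_eq.refl)
  with * show ?thesis
    unfolding presented_group_def monoid.simps by blast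
qed

lemma pres_eq_inverse:
  "w \<in> words X \<Longrightarrow> pres_eq X R (rev (map (\<lambda>(x, s). (x, \<not> s)) w) @ w) []"
proof (induction w)
  case Nil
  then show ?case by (simp add: pres_eq.refl)
next
  case (Cons l w)
  obtain x s where l: "l = (x, s)" by (cases l)
  let ?i = "rev (map (\<lambda>(x, s). (x, \<not> s)) w)"
  have w: "w \<in> words X" "x \<in> X" using Cons.prems l by auto
  have i: "?i \<in> words X"
    using w(1) by (fastforce simp: words_def)
  have "pres_eq X R (?i @ [(x, \<not> s), (x, \<not> \<not> s)] @ w) (?i @ w)"
    using i w by (intro pres_eq.cancel)
  then have "pres_eq X R (?i @ [(x, \<not> s), (x, \<not> \<not> s)] @ w) []"
    using Cons.IH[OF w(1)] by (rule pres_eq.trans)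
  then show ?case
    by (simp add: l)
qed

theorem group_presented_group: "group (presented_group X R)"
proof (rule groupI)
  fix P assume "P \<in> carrier (presented_group X R)"
  then obtain w where w: "w \<in> words X" "P = pres_class X R w"
    by (auto simp: carrier_presented_group)
  let ?i = "rev (map (\<lambda>(x, s). (x, \<not> s)) w)"
  have "?i \<in> words X"
    using w(1) by (fastforce simp: words_def)
  with w show "\<exists>Q\<in>carrier (presented_group X R). Q \<otimes>\<^bsub>presented_group X R\<^esub> P = \<one>\<^bsub>presented_group X R\<^esub>"
    by (intro bexI[of _ "pres_class X R ?i"])
      (auto simp: mult_presented_group one_presented_group pres_class_eq_iff
        pres_eq_inverse carrier_presented_group)
qed (auto simp: carrier_presented_group mult_presented_group one_presented_group)

definition eval_word :: "('b, 'c) monoid_scheme \<Rightarrow> ('a \<Rightarrow> 'b) \<Rightarrow> 'a word \<Rightarrow> 'b" where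
  "eval_word G f w = foldr (\<lambda>(x, s) g. (if s then f x else inv\<^bsub>G\<^esub> f x) \<otimes>\<^bsub>G\<^esub> g) w \<one>\<^bsub>G\<^esub>"

lemma (in group) eval_word_closed:
  assumes "f \<in> X \<rightarrow> carrier G" "w \<in> words X"
  shows "eval_word G f w \<in> carrier G"
  using assms(2) by (induction w) (use assms(1) in \<open>auto simp: eval_word_def Pi_iff\<close>)

lemma (in group) eval_word_append:
  assumes "f \<in> X \<rightarrow> carrier G" "u \<in> words X" "v \<in> words X"
  shows "eval_word G f (u @ v) = eval_word G f u \<otimes> eval_word G f v"
  using assms(2)
proof (induction u)
  case Nil
  then show ?case
    using eval_word_closed[OF assms(1,3)] by (simp add: eval_word_def)
next
  case (Cons l u)
  obtain x s where l: "l = (x, s)" by (cases l)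
  have u: "u \<in> words X" "f x \<in> carrier G"
    using Cons.prems assms(1) l by auto
  have "eval_word G f (l # w) = (if s then f x else inv f x) \<otimes> eval_word G f w" for w
    by (simp add: eval_word_def l)
  then show ?case
    using Cons.IH u eval_word_closed[OF assms(1)] assms(3) by (simp add: m_assoc)
qed

lemma (in group) eval_word_pres_eq:
  assumes "f \<in> X \<rightarrow> carrier G" "\<And>r. r \<in> R \<Longrightarrow> eval_word G f r = \<one>" "pres_eq X R u v"
  shows "eval_word G f u = eval_word G f v"
  using assms(3)
proof (induction rule: pres_eq.induct)
  case (cancel u v x s)
  have "f x \<in> carrier G" using cancel assms(1) by auto
  then have "eval_word G f [(x, s), (x, \<not> s)] = \<one>"
    by (simp add: eval_word_def)
  then show ?case
    using cancel eval_word_append[OF assms(1)] eval_word_closed[OF assms(1)]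
    by (simp del: append_Cons)
next
  case (relator u v r)
  then show ?case
    using eval_word_append[OF assms(1)] eval_word_closed[OF assms(1)] assms(2) by simp
qed auto

theorem (in group) presented_group_universal:
  assumes f: "f \<in> X \<rightarrow> carrier G" and R: "\<And>r. r \<in> R \<Longrightarrow> eval_word G f r = \<one>"
  shows "\<exists>h\<in>hom (presented_group X R) G. \<forall>w\<in>words X. h (pres_class X R w) = eval_word G f w"
proof -
  define h where "h = (\<lambda>P. eval_word G f (SOME w. w \<in> P))"
  have h: "h (pres_class X R w) = eval_word G f w" if "w \<in> words X" for w
  proof -
    have "w \<in> pres_class X R w"
      using that by (simp add: mem_pres_class pres_eq.refl)
    then have "(SOME v. v \<in> pres_class X R w) \<in> pres_class X R w"
      by (rule someI)
    then show ?thesis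
      unfolding h_def using eval_word_pres_eq[OF f R] by (metis mem_pres_class)
  qed
  moreover have "h \<in> hom (presented_group X R) G"
    by (rule homI) (auto simp: carrier_presented_group mult_presented_group h
        eval_word_closed[OF f] eval_word_append[OF f])
  ultimately show ?thesis by blast
qed

lemma relator_trivial:
  "r \<in> R \<Longrightarrow> r \<in> words X \<Longrightarrow> pres_class X R r = \<one>\<^bsub>presented_group X R\<^esub>"
  using pres_eq.relator[of "[]" X "[]" r R]
  by (simp add: one_presented_group pres_class_eq_iff)

lemma pres_class_eq_eval_word:
  assumes "w \<in> words X"
  shows "pres_class X R w = eval_word (presented_group X R) (pres_gen X R) w"
  using assms
proof (induction w)
  case Nil
  then show ?case by (simp add: eval_word_def one_presented_group)
next
  case (Cons l w)
  interpret G: group "presented_group X R" by (rule group_presented_group)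
  obtain x s where l: "l = (x, s)" by (cases l)
  have x: "x \<in> X" "w \<in> words X" using Cons.prems l by auto
  have "pres_class X R [(x, False)] \<otimes>\<^bsub>presented_group X R\<^esub> pres_gen X R x
      = \<one>\<^bsub>presented_group X R\<^esub>"
    using x pres_eq.cancel[of "[]" X "[]" x R False]
    by (simp add: pres_gen_def mult_presented_group one_presented_group pres_class_eq_iff)
  then have "inv\<^bsub>presented_group X R\<^esub> pres_gen X R x = pres_class X R [(x, False)]"
    using x by (intro G.inv_equality) (auto simp: carrier_presented_group pres_gen_def)
  moreover have "pres_class X R (l # w)
      = pres_class X R [l] \<otimes>\<^bsub>presented_group X R\<^esub> pres_class X R w"
    using x l by (simp add: mult_presented_group)
  ultimately show ?case
    using Cons.IH x l by (cases s) (simp_all add: eval_word_def pres_gen_def)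
qed

lemma group_pc_group: "group (\<G> \<Gamma>)"
  by (simp add: pc_group_def group_presented_group)

end

theory Submission
  imports Defs "HOL-Algebra.Coset"
begin

text \<open>In a partially commutative group a nonempty word represents \<open>1\<close> only if it contains a letter
  and its inverse separated by letters commuting with it; otherwise it is called reduced. Let \<open>w\<close> be
  a reduced word of \<open>\<G> \<Gamma>\<^sub>1\<close>. As \<open>a\<^sub>1\<close> commutes with every generator but \<open>b\<close>, and \<open>a\<^sub>2\<close> with every
  generator but \<open>c\<close>, the letters \<open>a\<^sub>1\<close> of \<open>\<phi>(w)\<close> can be collected in front of the next \<open>b\<close> and the
  letters \<open>a\<^sub>2\<close> in front of the next \<open>c\<close>. If the result had a cancelling pair \<open>b \<dots> b\<^sup>-\<^sup>1\<close>, then in \<open>w\<close> only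
  powers of \<open>a\<close>, with exponent sum \<open>0\<close>, and of \<open>e\<close> would lie in between; since \<open>a\<close> and \<open>e\<close> commute,
  \<open>w\<close> would not be reduced. The other generators are similar, so the result is reduced and
  \<open>\<phi>(w) = 1\<close> forces \<open>w\<close> to be empty.\<close>

section \<open>Reduced words\<close>

text \<open>The letter \<open>(x, s)\<close> put in front of \<open>w\<close> can be moved up to an
  inverse letter. The search ends at the first letter \<open>x\<close>: beyond an equal letter
  nothing is lost, because \<open>reduced\<close> tests that letter on its own.\<close>

primrec cancels :: "'a set set \<Rightarrow> 'a \<Rightarrow> bool \<Rightarrow> 'a word \<Rightarrow> bool" where
  "cancels E x s [] \<longleftrightarrow> False"
| "cancels E x s (l # w) \<longleftrightarrow>
    (if fst l = x then snd l \<noteq> s else {x, fst l} \<in> E \<and> cancels E x s w)"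

primrec reduced :: "'a set set \<Rightarrow> 'a word \<Rightarrow> bool" where
  "reduced E [] \<longleftrightarrow> True"
| "reduced E (l # w) \<longleftrightarrow> \<not> cancels E (fst l) (snd l) w \<and> reduced E w"

section \<open>Pilings\<close>

text \<open>Every vertex carries a stack over \<open>{+, -, 0}\<close>, encoded as \<^typ>\<open>bool option\<close>. Multiplication by
  \<open>x\<close> puts \<open>+\<close> on the stack of \<open>x\<close> and \<open>0\<close> on the stacks of all vertices not commuting with
  \<open>x\<close>, unless it cancels a \<open>-\<close> on top of the stack of \<open>x\<close> (Crisp, Godelle and Wiest).\<close>

type_synonym 'a piling = "'a \<Rightarrow> bool option list"

definition push :: "'a set set \<Rightarrow> 'a \<Rightarrow> bool \<Rightarrow> 'a piling \<Rightarrow> 'a piling" where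
  "push E x s P = (\<lambda>z. if z = x then Some s # P z else if {x, z} \<in> E then P z else None # P z)"

definition pop :: "'a set set \<Rightarrow> 'a \<Rightarrow> 'a piling \<Rightarrow> 'a piling" where
  "pop E x P = (\<lambda>z. if z \<noteq> x \<and> {x, z} \<in> E then P z else tl (P z))"

definition top_is :: "'a piling \<Rightarrow> 'a \<Rightarrow> bool \<Rightarrow> bool" where
  "top_is P x s \<longleftrightarrow> (\<exists>r. P x = Some s # r)"

definition pile_act :: "'a set set \<Rightarrow> 'a \<Rightarrow> bool \<Rightarrow> 'a piling \<Rightarrow> 'a piling" where
  "pile_act E x s P = (if top_is P x (\<not> s) then pop E x P else push E x s P)"

definition pile :: "'a set set \<Rightarrow> 'a word \<Rightarrow> 'a piling \<Rightarrow> 'a piling" where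
  "pile E = foldr (\<lambda>(x, s). pile_act E x s)"

text \<open>Pilings built from the empty one by pushes that meet no inverse on top. On other pilings
  \<open>pop\<close> may remove entries different from \<open>0\<close> from the stacks of vertices
  not commuting with \<open>x\<close>, and then the action is not invertible.\<close>

inductive valid_piling :: "'a set set \<Rightarrow> 'a piling \<Rightarrow> bool" for E where
  empty: "valid_piling E (\<lambda>_. [])"
| step: "valid_piling E P \<Longrightarrow> \<not> top_is P x (\<not> s) \<Longrightarrow> valid_piling E (push E x s P)"

lemma pile_simps [simp]:
  "pile E [] P = P"
  "pile E ((x, s) # w) P = pile_act E x s (pile E w P)"
  "pile E (u @ v) P = pile E u (pile E v P)"
  by (simp_all add: pile_def)

lemma pop_push [simp]: "pop E x (push E x s P) = P"
  by (auto simp: pop_def push_def)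

lemma top_is_push [simp]: "top_is (push E x s P) x t \<longleftrightarrow> t = s"
  by (auto simp: top_is_def push_def)

lemma top_is_push_other:
  "x \<noteq> y \<Longrightarrow> top_is (push E x s P) y t \<longleftrightarrow> {x, y} \<in> E \<and> top_is P y t"
  by (simp add: top_is_def push_def)

lemma push_push_adjacent:
  "x \<noteq> y \<Longrightarrow> {x, y} \<in> E \<Longrightarrow> push E x s (push E y t P) = push E y t (push E x s P)"
  by (auto simp: push_def insert_commute fun_eq_iff)

text \<open>A signed entry on top of the stack of \<open>x\<close> shows that the last push was at
  \<open>x\<close> or at a neighbour, as any other push would have put \<open>0\<close> there.
  Pushes at neighbours commute, so the push at \<open>x\<close> can be made the last one.\<close>

lemma valid_piling_top:
  assumes "valid_piling E P" "top_is P x s"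
  obtains Q where "valid_piling E Q" "\<not> top_is Q x (\<not> s)" "P = push E x s Q"
proof -
  have "\<exists>Q. valid_piling E Q \<and> \<not> top_is Q x (\<not> s) \<and> P = push E x s Q"
    using assms
  proof (induction arbitrary: x s)
    case empty
    then show ?case by (simp add: top_is_def)
  next
    case (step P y t)
    show ?case
    proof (cases "y = x")
      case True
      then show ?thesis using step by auto
    next
      case False
      then have adj: "{y, x} \<in> E" "{x, y} \<in> E"
        using step.prems top_is_push_other by (metis, metis insert_commute)
      then have "top_is P x s"
        using step.prems False top_is_push_other by metis
      then obtain Q where Q: "valid_piling E Q" "\<not> top_is Q x (\<not> s)" "P = push E x s Q"
        using step.IH by blast
      have "valid_piling E (push E y t Q)"
        using step.hyps Q False adj top_is_push_other by (metis valid_piling.step)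
      moreover have "\<not> top_is (push E y t Q) x (\<not> s)"
        using Q(2) False adj by (simp add: top_is_push_other)
      ultimately show ?thesis
        using Q(3) False adj push_push_adjacent by metis
    qed
  qed
  with that show thesis by blast
qed

lemma valid_piling_act:
  assumes "valid_piling E P"
  shows "valid_piling E (pile_act E x s P)"
proof (cases "top_is P x (\<not> s)")
  case True
  with assms obtain Q where "valid_piling E Q" "P = push E x (\<not> s) Q"
    by (metis valid_piling_top)
  with True show ?thesis by (simp add: pile_act_def)
next
  case False
  with assms show ?thesis by (simp add: pile_act_def valid_piling.step)
qed

lemma valid_piling_pile: "valid_piling E P \<Longrightarrow> valid_piling E (pile E w P)"
  by (induction w) (auto intro: valid_piling_act)

text \<open>If \<open>(x, \<not> s)\<close> pops, validity ensures that the piling left has no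
  \<open>\<not> s\<close> on top of the stack of \<open>x\<close>, so \<open>(x, s)\<close> pushes
  the entry back.\<close>

lemma pile_act_inverse:
  assumes "valid_piling E P"
  shows "pile_act E x s (pile_act E x (\<not> s) P) = P"
proof (cases "top_is P x s")
  case True
  with assms obtain Q where "\<not> top_is Q x (\<not> s)" "P = push E x s Q"
    by (metis valid_piling_top)
  then show ?thesis by (simp add: pile_act_def)
next
  case False
  then show ?thesis by (simp add: pile_act_def)
qed

lemma pile_act_commute:
  assumes "valid_piling E P" "x \<noteq> y" "{x, y} \<in> E"
  shows "pile_act E x s (pile_act E y t P) = pile_act E y t (pile_act E x s P)"
proof -
  \<comment> \<open>The case where one letter pops, stated for general letters so that it serves for
    either of the two. The piling is a push at \<open>y'\<close>, which the action of
    \<open>x'\<close> leaves in place.\<close>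
  have push_pop: "pile_act E x' s' (pile_act E y' t' P) = pile_act E y' t' (pile_act E x' s' P)"
    if "x' \<noteq> y'" "{x', y'} \<in> E" and top: "top_is P y' (\<not> t')" for x' y' s' t'
  proof -
    obtain Q where Q: "valid_piling E Q" "P = push E y' (\<not> t') Q" "\<not> top_is Q y' t'"
      using valid_piling_top[OF assms(1) top] by auto
    have adj: "{y', x'} \<in> E" using that(2) by (simp add: insert_commute)
    have P: "pile_act E y' t' P = Q"
      using Q by (simp add: pile_act_def)
    have top_Q: "top_is P x' (\<not> s') \<longleftrightarrow> top_is Q x' (\<not> s')"
      using Q(2) that(1) adj by (simp add: top_is_push_other)
    show ?thesis
    proof (cases "top_is Q x' (\<not> s')")
      case True
      then obtain Q' where Q': "Q = push E x' (\<not> s') Q'"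
        using valid_piling_top[OF Q(1)] by metis
      have "P = push E x' (\<not> s') (push E y' (\<not> t') Q')"
        using Q(2) Q' that by (metis push_push_adjacent)
      then have "pile_act E x' s' P = push E y' (\<not> t') Q'"
        by (simp add: pile_act_def)
      moreover have "pile_act E x' s' Q = Q'"
        using Q' by (simp add: pile_act_def)
      ultimately show ?thesis
        using P by (simp add: pile_act_def)
    next
      case False
      then have "pile_act E x' s' P = push E y' (\<not> t') (push E x' s' Q)"
        using top_Q Q(2) that by (metis pile_act_def push_push_adjacent)
      moreover have "pile_act E x' s' Q = push E x' s' Q"
        using False by (simp add: pile_act_def)
      ultimately show ?thesis
        using P by (simp add: pile_act_def)
    qed
  qed
  have adj: "{y, x} \<in> E" using assms(3) by (simp add: insert_commute)
  consider "top_is P y (\<not> t)" | "top_is P x (\<not> s)"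
    | "\<not> top_is P y (\<not> t)" "\<not> top_is P x (\<not> s)" by blast
  then show ?thesis
  proof cases
    case 1
    then show ?thesis using push_pop assms by metis
  next
    case 2
    then show ?thesis using push_pop assms adj by metis
  next
    case 3
    then show ?thesis
      using assms adj push_push_adjacent[of x y E s t P]
      by (simp add: pile_act_def top_is_push_other)
  qed
qed

section \<open>Reduced words and the trivial element\<close>

lemma simple_graph_adjacent: "simple_graph \<Gamma> \<Longrightarrow> {x, y} \<in> snd \<Gamma> \<Longrightarrow> x \<noteq> y \<and> x \<in> fst \<Gamma> \<and> y \<in> fst \<Gamma>"
  by (fastforce simp: simple_graph_def)

text \<open>Inverse letters undo each other and adjacent letters commute on valid pilings, so the
  action respects trivial pairs and relators.\<close>

lemma pile_pres_eq:
  assumes "simple_graph \<Gamma>" "pres_eq (fst \<Gamma>) (pc_relators \<Gamma>) u v"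
  shows "pile (snd \<Gamma>) u (\<lambda>_. []) = pile (snd \<Gamma>) v (\<lambda>_. [])"
  using assms(2)
proof (induction rule: pres_eq.induct)
  case (cancel u v x s)
  show ?case
    using pile_act_inverse[OF valid_piling_pile[OF valid_piling.empty], of "snd \<Gamma>" x s v] by simp
next
  case (relator u v r)
  then obtain x y where r: "r = commutator_word x y" and e: "{x, y} \<in> snd \<Gamma>"
    by (auto simp: pc_relators_def)
  let ?P = "pile (snd \<Gamma>) v (\<lambda>_. [])"
  have v: "valid_piling (snd \<Gamma>) ?P"
    by (rule valid_piling_pile[OF valid_piling.empty])
  have "x \<noteq> y" using simple_graph_adjacent[OF assms(1) e] by simp
  \<comment> \<open>In y^-1 x y the letters x and y are swapped, then y^-1 cancels y. The relator
    thus acts as x^-1 x.\<close>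
  then have "pile_act (snd \<Gamma>) y False (pile_act (snd \<Gamma>) x True (pile_act (snd \<Gamma>) y True ?P))
      = pile_act (snd \<Gamma>) x True ?P"
    using pile_act_commute[OF v _ e, of True True]
      pile_act_inverse[OF valid_piling_act[OF v], of y False x True] by simp
  then have "pile (snd \<Gamma>) r ?P = ?P"
    using pile_act_inverse[OF v, of x False] by (simp add: r commutator_word_def)
  then show ?case by simp
qed auto

text \<open>No letter of a reduced word pops, since a pop would be a cancellation with the letters
  after it. A piling made by pushes alone shows on its tops what a further letter in front could
  cancel.\<close>

lemma top_is_pile_reduced:
  "reduced E w \<Longrightarrow> top_is (pile E w (\<lambda>_. [])) x t \<longleftrightarrow> cancels E x (\<not> t) w"
proof (induction w arbitrary: x t)
  case Nil
  then show ?case by (simp add: top_is_def)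
next
  case (Cons l w)
  obtain y s where l: "l = (y, s)" by (cases l)
  have "pile E (l # w) (\<lambda>_. []) = push E y s (pile E w (\<lambda>_. []))"
    using Cons l by (simp add: pile_act_def)
  then show ?case
    using Cons l by (auto simp: top_is_push_other insert_commute)
qed

text \<open>The first letter of a nonempty reduced word pushes an entry on its own stack, whereas
  \<open>[]\<close> leaves the empty piling.\<close>

theorem reduced_nontrivial:
  assumes "simple_graph \<Gamma>" "reduced (snd \<Gamma>) w" "pres_eq (fst \<Gamma>) (pc_relators \<Gamma>) w []"
  shows "w = []"
proof (cases w)
  case (Cons l v)
  obtain x s where l: "l = (x, s)" by (cases l)
  have "pile (snd \<Gamma>) w (\<lambda>_. []) = push (snd \<Gamma>) x s (pile (snd \<Gamma>) v (\<lambda>_. []))"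
    using assms(2) Cons l by (simp add: pile_act_def top_is_pile_reduced)
  then have "push (snd \<Gamma>) x s (pile (snd \<Gamma>) v (\<lambda>_. [])) x = []"
    using pile_pres_eq[OF assms(1,3)] by simp
  then show ?thesis by (simp add: push_def)
qed

section \<open>Every element is represented by a reduced word\<close>

definition sign :: "bool \<Rightarrow> int" where
  "sign s = (if s then 1 else - 1)"

lemma (in group) commutes_int_pow:
  assumes "x \<otimes> y = y \<otimes> x" "x \<in> carrier G" "y \<in> carrier G"
  shows "x [^] (i::int) \<otimes> y = y \<otimes> x [^] i"
proof -
  have pow: "x [^] n \<otimes> y = y \<otimes> x [^] n" for n :: nat
    using assms by (rule group_commutes_pow)
  have inv: "inv g \<otimes> y = y \<otimes> inv g" if "g \<otimes> y = y \<otimes> g" "g \<in> carrier G" for g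
  proof -
    have "inv g \<otimes> y = inv g \<otimes> (y \<otimes> g) \<otimes> inv g"
      using that(2) assms(3) by (simp add: m_assoc)
    also have "\<dots> = inv g \<otimes> (g \<otimes> y) \<otimes> inv g"
      using that(1) by simp
    also have "\<dots> = y \<otimes> inv g"
      using that(2) assms(3) by (simp add: m_assoc[symmetric])
    finally show ?thesis .
  qed
  show ?thesis
    by (auto simp only: int_pow_def2 split: if_split intro!: pow inv nat_pow_closed assms)
qed

lemma (in group) commutes_int_pow_int_pow:
  assumes "x \<otimes> y = y \<otimes> x" "x \<in> carrier G" "y \<in> carrier G"
  shows "x [^] (i::int) \<otimes> y [^] (j::int) = y [^] j \<otimes> x [^] i"
  using commutes_int_pow[OF commutes_int_pow[OF assms, symmetric]] assms by simp

lemma (in group) eval_word_Nil [simp]: "eval_word G f [] = \<one>"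
  by (simp add: eval_word_def)

lemma (in group) eval_word_Cons:
  "f x \<in> carrier G \<Longrightarrow> eval_word G f ((x, s) # w) = f x [^] sign s \<otimes> eval_word G f w"
  by (simp add: eval_word_def sign_def int_pow_neg)

lemma (in group) eval_commutator_word:
  assumes "f x \<in> carrier G" "f y \<in> carrier G"
  shows "eval_word G f (commutator_word x y) = \<one> \<longleftrightarrow> f x \<otimes> f y = f y \<otimes> f x"
proof -
  have "eval_word G f (commutator_word x y) = inv (f y \<otimes> f x) \<otimes> (f x \<otimes> f y)"
    using assms by (simp add: eval_word_def commutator_word_def m_assoc inv_mult_group)
  then show ?thesis
    using assms by (simp add: inv_solve_left')
qed

lemma pc_gen_closed: "x \<in> fst \<Gamma> \<Longrightarrow> pc_gen \<Gamma> x \<in> carrier (\<G> \<Gamma>)"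
  by (simp add: pc_gen_def pres_gen_def pc_group_def carrier_presented_group)

lemma pc_class_eq_eval_word:
  "w \<in> words (fst \<Gamma>) \<Longrightarrow>
    pres_class (fst \<Gamma>) (pc_relators \<Gamma>) w = eval_word (\<G> \<Gamma>) (pc_gen \<Gamma>) w"
  using pres_class_eq_eval_word[of w "fst \<Gamma>" "pc_relators \<Gamma>"]
  by (simp add: pc_group_def pc_gen_def[abs_def])

lemma pc_gen_commute:
  assumes "simple_graph \<Gamma>" "{x, y} \<in> snd \<Gamma>"
  shows "pc_gen \<Gamma> x \<otimes>\<^bsub>\<G> \<Gamma>\<^esub> pc_gen \<Gamma> y = pc_gen \<Gamma> y \<otimes>\<^bsub>\<G> \<Gamma>\<^esub> pc_gen \<Gamma> x"
proof -
  interpret G: group "\<G> \<Gamma>" by (rule group_pc_group)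
  have xy: "x \<in> fst \<Gamma>" "y \<in> fst \<Gamma>"
    using simple_graph_adjacent[OF assms] by auto
  have "commutator_word x y \<in> pc_relators \<Gamma>"
    using assms(2) by (auto simp: pc_relators_def)
  moreover have "commutator_word x y \<in> words (fst \<Gamma>)"
    using xy by (simp add: commutator_word_def)
  ultimately have "eval_word (\<G> \<Gamma>) (pc_gen \<Gamma>) (commutator_word x y) = \<one>\<^bsub>\<G> \<Gamma>\<^esub>"
    using relator_trivial pc_class_eq_eval_word by (metis pc_group_def)
  then show ?thesis
    using xy by (simp add: G.eval_commutator_word pc_gen_closed)
qed

text \<open>The letter is moved to the right through letters commuting with it until it meets its
  inverse and both vanish; \<open>v\<close> is \<open>w\<close> without that inverse.\<close>

lemma cancels_shorter:
  assumes "simple_graph \<Gamma>" "x \<in> fst \<Gamma>" "w \<in> words (fst \<Gamma>)" "cancels (snd \<Gamma>) x s w"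
  shows "\<exists>v\<in>words (fst \<Gamma>). length v < length w \<and>
    eval_word (\<G> \<Gamma>) (pc_gen \<Gamma>) ((x, s) # w) = eval_word (\<G> \<Gamma>) (pc_gen \<Gamma>) v"
  using assms(3,4)
proof (induction w)
  case Nil
  then show ?case by simp
next
  case (Cons l w)
  interpret G: group "\<G> \<Gamma>" by (rule group_pc_group)
  obtain y t where l: "l = (y, t)" by (cases l)
  let ?e = "eval_word (\<G> \<Gamma>) (pc_gen \<Gamma>)"
  have y: "y \<in> fst \<Gamma>" "w \<in> words (fst \<Gamma>)" using Cons.prems l by auto
  have gens: "pc_gen \<Gamma> \<in> fst \<Gamma> \<rightarrow> carrier (\<G> \<Gamma>)"
    by (simp add: pc_gen_closed)
  note closed = pc_gen_closed[OF assms(2)] pc_gen_closed[OF y(1)] G.eval_word_closed[OF gens y(2)]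
  show ?case
  proof (cases "y = x")
    case True
    with Cons.prems l have "t = (\<not> s)" by auto
    then have "?e ((x, s) # l # w) = ?e w"
      using closed True by (simp add: l G.eval_word_Cons G.m_assoc[symmetric] G.int_pow_mult[symmetric])
        (simp add: sign_def)
    then show ?thesis
      using y by (intro bexI[of _ w]) auto
  next
    case False
    then have adj: "{x, y} \<in> snd \<Gamma>" and c: "cancels (snd \<Gamma>) x s w"
      using Cons.prems l by auto
    obtain v where v: "v \<in> words (fst \<Gamma>)" "length v < length w" "?e ((x, s) # w) = ?e v"
      using Cons.IH[OF y(2) c] by blast
    have "?e ((x, s) # l # w) = ?e (l # (x, s) # w)"
      using closed G.commutes_int_pow_int_pow[OF pc_gen_commute[OF assms(1) adj]]
      by (simp add: l G.eval_word_Cons G.m_assoc[symmetric])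
    also have "\<dots> = ?e (l # v)"
      using v(3) closed by (simp add: l G.eval_word_Cons)
    finally show ?thesis
      using v y by (intro bexI[of _ "l # v"]) (auto simp: l)
  qed
qed

lemma not_reduced_shorter:
  assumes "simple_graph \<Gamma>" "w \<in> words (fst \<Gamma>)" "\<not> reduced (snd \<Gamma>) w"
  shows "\<exists>v\<in>words (fst \<Gamma>). length v < length w \<and>
    eval_word (\<G> \<Gamma>) (pc_gen \<Gamma>) w = eval_word (\<G> \<Gamma>) (pc_gen \<Gamma>) v"
  using assms(2,3)
proof (induction w)
  case Nil
  then show ?case by simp
next
  case (Cons l w)
  interpret G: group "\<G> \<Gamma>" by (rule group_pc_group)
  obtain x s where l: "l = (x, s)" by (cases l)
  have x: "x \<in> fst \<Gamma>" "w \<in> words (fst \<Gamma>)" using Cons.prems l by auto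
  show ?case
  proof (cases "reduced (snd \<Gamma>) w")
    case True
    then have "cancels (snd \<Gamma>) x s w" using Cons.prems l by simp
    from cancels_shorter[OF assms(1) x this] show ?thesis
      unfolding l by (metis length_Cons less_SucI)
  next
    case False
    then obtain v where "v \<in> words (fst \<Gamma>)" "length v < length w"
      "eval_word (\<G> \<Gamma>) (pc_gen \<Gamma>) w = eval_word (\<G> \<Gamma>) (pc_gen \<Gamma>) v"
      using Cons.IH x by blast
    then show ?thesis
      using x by (intro bexI[of _ "l # v"]) (auto simp: l G.eval_word_Cons pc_gen_closed)
  qed
qed

lemma ex_reduced:
  assumes "simple_graph \<Gamma>" "w \<in> words (fst \<Gamma>)"
  shows "\<exists>v\<in>words (fst \<Gamma>). reduced (snd \<Gamma>) v \<and>
    eval_word (\<G> \<Gamma>) (pc_gen \<Gamma>) w = eval_word (\<G> \<Gamma>) (pc_gen \<Gamma>) v"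
  using assms(2)
proof (induction w rule: length_induct)
  case (1 w)
  then show ?case
    using not_reduced_shorter[OF assms(1)] by metis
qed

section \<open>Collecting the letters \<open>a\<^sub>1\<close> and \<open>a\<^sub>2\<close>\<close>

text \<open>Integer exponents let collected letters of opposite sign cancel by addition; exponent 0
  gives the empty word.\<close>

definition power_word :: "'a \<Rightarrow> int \<Rightarrow> 'a word" where
  "power_word x i = replicate (nat \<bar>i\<bar>) (x, 0 < i)"

lemma cancels_power_word:
  "cancels E x s (power_word y i @ w) \<longleftrightarrow>
    (if i = 0 then cancels E x s w
     else if y = x then (0 < i) \<noteq> s else {x, y} \<in> E \<and> cancels E x s w)"
proof -
  have "cancels E x s (replicate n (y, t) @ w) \<longleftrightarrow>
    (if n = 0 then cancels E x s w
     else if y = x then t \<noteq> s else {x, y} \<in> E \<and> cancels E x s w)" for n t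
    by (induction n) auto
  then show ?thesis by (simp add: power_word_def)
qed

text \<open>Equal letters stop each other's search, so only the last letter of the power meets
  \<open>w\<close>.\<close>

lemma reduced_power_word:
  "reduced E (power_word x i @ w) \<longleftrightarrow> (i = 0 \<or> \<not> cancels E x (0 < i) w) \<and> reduced E w"
proof -
  have "cancels E x t (replicate n (x, t) @ w) \<longleftrightarrow> n = 0 \<and> cancels E x t w" for n t
    by (induction n) auto
  then have "reduced E (replicate n (x, t) @ w) \<longleftrightarrow> (n = 0 \<or> \<not> cancels E x t w) \<and> reduced E w" for n t
    by (induction n) auto
  then show ?thesis by (auto simp: power_word_def)
qed

lemma power_word_eq_Nil [simp]: "power_word x i = [] \<longleftrightarrow> i = 0"
  by (simp add: power_word_def)

lemma (in group) eval_word_power_word: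
  assumes "f \<in> X \<rightarrow> carrier G" "x \<in> X" "w \<in> words X"
  shows "eval_word G f (power_word x i @ w) = f x [^] i \<otimes> eval_word G f w"
proof -
  have x: "f x \<in> carrier G" and w: "eval_word G f w \<in> carrier G"
    using assms eval_word_closed by auto
  have "eval_word G f (replicate n (x, t) @ w) = f x [^] (sign t * int n) \<otimes> eval_word G f w" for n t
  proof (induction n)
    case 0
    then show ?case using w by simp
  next
    case (Suc n)
    have "f x [^] (sign t * int (Suc n)) = f x [^] sign t \<otimes> f x [^] (sign t * int n)"
      using x by (simp add: int_pow_mult[symmetric] algebra_simps)
    then show ?case
      using Suc x w by (simp add: eval_word_Cons m_assoc)
  qed
  moreover have "sign (0 < i) * int (nat \<bar>i\<bar>) = i"
    by (simp add: sign_def)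
  ultimately show ?thesis by (simp add: power_word_def)
qed

text \<open>\<open>delay i j w\<close> represents \<open>a\<^sub>1\<^sup>i a\<^sub>2\<^sup>j \<phi>(w)\<close>: the letters \<open>a\<^sub>1\<close> are moved to the right until the next
  \<open>b\<close>, the letters \<open>a\<^sub>2\<close> until the next \<open>c\<close>.\<close>

fun delay :: "int \<Rightarrow> int \<Rightarrow> vertex1 word \<Rightarrow> vertex2 word" where
  "delay i j [] = power_word vertex2.A1 i @ power_word vertex2.A2 j"
| "delay i j ((vertex1.A, s) # w) = delay (i + sign s) (j + sign s) w"
| "delay i j ((vertex1.B, s) # w) = power_word vertex2.A1 i @ (vertex2.B, s) # delay 0 j w"
| "delay i j ((vertex1.C, s) # w) = power_word vertex2.A2 j @ (vertex2.C, s) # delay i 0 w"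
| "delay i j ((vertex1.D, s) # w) = (vertex2.D, s) # delay i j w"
| "delay i j ((vertex1.E, s) # w) = (vertex2.E, s) # delay i j w"

section \<open>Adjacency in the two graphs\<close>

lemma edge_\<Gamma>\<^sub>1: "{x, y} \<in> snd \<Gamma>\<^sub>1 \<longleftrightarrow> (x, y) \<in>
  {(vertex1.A, vertex1.D), (vertex1.A, vertex1.E), (vertex1.B, vertex1.E),
   (vertex1.C, vertex1.D), (vertex1.D, vertex1.E),
   (vertex1.D, vertex1.A), (vertex1.E, vertex1.A), (vertex1.E, vertex1.B),
   (vertex1.D, vertex1.C), (vertex1.E, vertex1.D)}"
  by (auto simp: \<Gamma>\<^sub>1_def doubleton_eq_iff)

text \<open>Listed by the five non-edges among the fifteen pairs: these are what stops a letter from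
  moving.\<close>

lemma edge_\<Gamma>\<^sub>2: "{x, y} \<in> snd \<Gamma>\<^sub>2 \<longleftrightarrow> x \<noteq> y \<and> (x, y) \<notin>
  {(vertex2.A1, vertex2.B), (vertex2.A2, vertex2.C), (vertex2.B, vertex2.C),
   (vertex2.B, vertex2.D), (vertex2.C, vertex2.E),
   (vertex2.B, vertex2.A1), (vertex2.C, vertex2.A2), (vertex2.C, vertex2.B),
   (vertex2.D, vertex2.B), (vertex2.E, vertex2.C)}"
  by (cases x; cases y) (simp_all add: \<Gamma>\<^sub>2_def doubleton_eq_iff)

lemma fst_\<Gamma>\<^sub>1 [simp]: "fst \<Gamma>\<^sub>1 = UNIV"
  by (auto simp: \<Gamma>\<^sub>1_def intro: vertex1.exhaust)

lemma fst_\<Gamma>\<^sub>2 [simp]: "fst \<Gamma>\<^sub>2 = UNIV"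
  by (auto simp: \<Gamma>\<^sub>2_def intro: vertex2.exhaust)

lemma words_UNIV [simp]: "w \<in> words UNIV"
  by (simp add: words_def)

lemma sign_nonzero [simp]: "sign s \<noteq> 0" and sign_pos [simp]: "0 < sign s \<longleftrightarrow> s"
  by (simp_all add: sign_def)

text \<open>Serves the inductions over \<open>delay\<close>, where a letter \<open>(A, t)\<close>
  joins a pending exponent \<open>i\<close>. Were \<open>i\<close> zero or of the sign of
  \<open>t\<close>, then \<open>i + sign t\<close> would be nonzero of that sign, and the
  assumptions would contradict each other.\<close>

lemma cancels_A_step:
  assumes "\<not> cancels E A t w" "if i + sign t = 0 then P else cancels E A (0 < i + sign t) w"
  shows "i \<noteq> 0 \<and> t \<noteq> (0 < i)"
  using assms by (cases t; cases "1 < i"; cases "0 < i") (auto simp: sign_def split: if_splits)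

text \<open>Letters c and d block b, and so does a_1, so the pending a_1 must be used up before the
  inverse of b. The letters a on the way are separated by e only, hence of equal sign as
  \<open>w\<close> is reduced. So there is none if \<open>i\<close> is 0, and otherwise the first is
  opposite to \<open>i\<close>.\<close>

lemma cancels_delay_B:
  assumes "reduced (snd \<Gamma>\<^sub>1) w" "cancels (snd \<Gamma>\<^sub>2) vertex2.B s (delay i j w)"
  shows "if i = 0 then cancels (snd \<Gamma>\<^sub>1) vertex1.B s w else cancels (snd \<Gamma>\<^sub>1) vertex1.A (0 < i) w"
  using assms
proof (induction i j w rule: delay.induct)
  case (2 i j t w)
  then have "if i + sign t = 0 then cancels (snd \<Gamma>\<^sub>1) vertex1.B s w
    else cancels (snd \<Gamma>\<^sub>1) vertex1.A (0 < i + sign t) w" by simp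
  \<comment> \<open>The letter a at the head has the sign opposite to \<open>i\<close>, so it is
    itself the inverse sought.\<close>
  from cancels_A_step[OF _ this] 2 show ?case by simp
qed (auto simp: cancels_power_word edge_\<Gamma>\<^sub>1 edge_\<Gamma>\<^sub>2
    cancels_power_word[where w = "[]", simplified] split: if_splits)

text \<open>Mirror image of the case of b: a_2 and \<open>j\<close> replace a_1 and
  \<open>i\<close>, and d replaces e as the letter commuting with both c and a.\<close>

lemma cancels_delay_C:
  assumes "reduced (snd \<Gamma>\<^sub>1) w" "cancels (snd \<Gamma>\<^sub>2) vertex2.C s (delay i j w)"
  shows "if j = 0 then cancels (snd \<Gamma>\<^sub>1) vertex1.C s w else cancels (snd \<Gamma>\<^sub>1) vertex1.A (0 < j) w"
  using assms
proof (induction i j w rule: delay.induct)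
  case (2 i j t w)
  then have "if j + sign t = 0 then cancels (snd \<Gamma>\<^sub>1) vertex1.C s w
    else cancels (snd \<Gamma>\<^sub>1) vertex1.A (0 < j + sign t) w" by simp
  from cancels_A_step[OF _ this] 2 show ?case by simp
qed (auto simp: cancels_power_word edge_\<Gamma>\<^sub>1 edge_\<Gamma>\<^sub>2
    cancels_power_word[where w = "[]", simplified] split: if_splits)

text \<open>The letter d commutes with a in \<open>\<Gamma>\<^sub>1\<close> and with a_1, a_2 in
  \<open>\<Gamma>\<^sub>2\<close>, and the other letters keep their order and their adjacency to d.
  The same reason applies to e.\<close>

lemma cancels_delay_D:
  "cancels (snd \<Gamma>\<^sub>2) vertex2.D s (delay i j w) \<Longrightarrow> cancels (snd \<Gamma>\<^sub>1) vertex1.D s w"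
  by (induction i j w rule: delay.induct)
    (auto simp: cancels_power_word edge_\<Gamma>\<^sub>1 edge_\<Gamma>\<^sub>2
      cancels_power_word[where w = "[]", simplified] split: if_splits)

lemma cancels_delay_E:
  "cancels (snd \<Gamma>\<^sub>2) vertex2.E s (delay i j w) \<Longrightarrow> cancels (snd \<Gamma>\<^sub>1) vertex1.E s w"
  by (induction i j w rule: delay.induct)
    (auto simp: cancels_power_word edge_\<Gamma>\<^sub>1 edge_\<Gamma>\<^sub>2
      cancels_power_word[where w = "[]", simplified] split: if_splits)

text \<open>Powers of a_1 stop in front of b and powers of a_2 in front of c, which do not commute
  with them, so they meet no inverse. Just after b or c the respective exponent is 0, so a
  cancellation of that letter would already occur in \<open>w\<close>.\<close>

lemma reduced_delay:
  "reduced (snd \<Gamma>\<^sub>1) w \<Longrightarrow> reduced (snd \<Gamma>\<^sub>2) (delay i j w)"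
proof (induction i j w rule: delay.induct)
  case (3 i j s w)
  then show ?case
    using cancels_delay_B[of w s 0 j] by (auto simp: reduced_power_word edge_\<Gamma>\<^sub>2)
next
  case (4 i j s w)
  then show ?case
    using cancels_delay_C[of w s i 0] by (auto simp: reduced_power_word edge_\<Gamma>\<^sub>2)
next
  case (5 i j s w)
  then show ?case using cancels_delay_D by auto
next
  case (6 i j s w)
  then show ?case using cancels_delay_E by auto
qed (auto simp: reduced_power_word reduced_power_word[where w = "[]", simplified]
    cancels_power_word[where w = "[]", simplified])

text \<open>Only letters a can disappear, and in a reduced word of letters a they all have one sign.
  So they add up to \<open>- i\<close> only if there are none or they are opposite to
  \<open>i\<close>.\<close>

lemma delay_eq_Nil:
  assumes "reduced (snd \<Gamma>\<^sub>1) w" "delay i j w = []"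
  shows "if i = 0 then w = [] else cancels (snd \<Gamma>\<^sub>1) vertex1.A (0 < i) w"
  using assms
proof (induction i j w rule: delay.induct)
  case (2 i j t w)
  then have "if i + sign t = 0 then w = []
    else cancels (snd \<Gamma>\<^sub>1) vertex1.A (0 < i + sign t) w" by simp
  from cancels_A_step[OF _ this] 2 show ?case by simp
qed auto

section \<open>The embedding\<close>

fun phi_gen :: "vertex1 \<Rightarrow> vertex2 word set" where
  "phi_gen vertex1.A = pc_gen \<Gamma>\<^sub>2 vertex2.A1 \<otimes>\<^bsub>\<G> \<Gamma>\<^sub>2\<^esub> pc_gen \<Gamma>\<^sub>2 vertex2.A2"
| "phi_gen vertex1.B = pc_gen \<Gamma>\<^sub>2 vertex2.B"
| "phi_gen vertex1.C = pc_gen \<Gamma>\<^sub>2 vertex2.C"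
| "phi_gen vertex1.D = pc_gen \<Gamma>\<^sub>2 vertex2.D"
| "phi_gen vertex1.E = pc_gen \<Gamma>\<^sub>2 vertex2.E"

interpretation G2: group "\<G> \<Gamma>\<^sub>2" by (rule group_pc_group)

lemma pc_gen_\<Gamma>\<^sub>2_closed [simp]: "pc_gen \<Gamma>\<^sub>2 x \<in> carrier (\<G> \<Gamma>\<^sub>2)"
  by (simp add: pc_gen_closed)

lemma phi_gen_closed [simp]: "phi_gen x \<in> carrier (\<G> \<Gamma>\<^sub>2)"
  by (cases x) simp_all

lemma eval_word_\<Gamma>\<^sub>2_closed [simp]:
  "eval_word (\<G> \<Gamma>\<^sub>2) (pc_gen \<Gamma>\<^sub>2) w \<in> carrier (\<G> \<Gamma>\<^sub>2)"
  "eval_word (\<G> \<Gamma>\<^sub>2) phi_gen v \<in> carrier (\<G> \<Gamma>\<^sub>2)"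
  by (rule G2.eval_word_closed[where X = UNIV]; simp)+

lemma eval_power_word_\<Gamma>\<^sub>2:
  "eval_word (\<G> \<Gamma>\<^sub>2) (pc_gen \<Gamma>\<^sub>2) (power_word x i @ w) =
    pc_gen \<Gamma>\<^sub>2 x [^]\<^bsub>\<G> \<Gamma>\<^sub>2\<^esub> i \<otimes>\<^bsub>\<G> \<Gamma>\<^sub>2\<^esub> eval_word (\<G> \<Gamma>\<^sub>2) (pc_gen \<Gamma>\<^sub>2) w"
  by (rule G2.eval_word_power_word[where X = UNIV]) simp_all

lemma pc_gen_\<Gamma>\<^sub>2_commute:
  assumes "{x, y} \<in> snd \<Gamma>\<^sub>2"
  shows "pc_gen \<Gamma>\<^sub>2 x [^]\<^bsub>\<G> \<Gamma>\<^sub>2\<^esub> (i::int) \<otimes>\<^bsub>\<G> \<Gamma>\<^sub>2\<^esub> pc_gen \<Gamma>\<^sub>2 y [^]\<^bsub>\<G> \<Gamma>\<^sub>2\<^esub> (j::int)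
    = pc_gen \<Gamma>\<^sub>2 y [^]\<^bsub>\<G> \<Gamma>\<^sub>2\<^esub> j \<otimes>\<^bsub>\<G> \<Gamma>\<^sub>2\<^esub> pc_gen \<Gamma>\<^sub>2 x [^]\<^bsub>\<G> \<Gamma>\<^sub>2\<^esub> i"
  using G2.commutes_int_pow_int_pow[OF pc_gen_commute[OF simple_graph_\<Gamma>\<^sub>2 assms]] by simp

lemma pc_gen_\<Gamma>\<^sub>2_left_commute:
  assumes "{x, y} \<in> snd \<Gamma>\<^sub>2" "g \<in> carrier (\<G> \<Gamma>\<^sub>2)"
  shows "pc_gen \<Gamma>\<^sub>2 x [^]\<^bsub>\<G> \<Gamma>\<^sub>2\<^esub> (i::int) \<otimes>\<^bsub>\<G> \<Gamma>\<^sub>2\<^esub> (pc_gen \<Gamma>\<^sub>2 y [^]\<^bsub>\<G> \<Gamma>\<^sub>2\<^esub> (j::int) \<otimes>\<^bsub>\<G> \<Gamma>\<^sub>2\<^esub> g)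
    = pc_gen \<Gamma>\<^sub>2 y [^]\<^bsub>\<G> \<Gamma>\<^sub>2\<^esub> j \<otimes>\<^bsub>\<G> \<Gamma>\<^sub>2\<^esub> (pc_gen \<Gamma>\<^sub>2 x [^]\<^bsub>\<G> \<Gamma>\<^sub>2\<^esub> i \<otimes>\<^bsub>\<G> \<Gamma>\<^sub>2\<^esub> g)"
  using pc_gen_\<Gamma>\<^sub>2_commute[OF assms(1), of i j] assms(2) by (simp add: G2.m_assoc[symmetric])

lemma phi_gen_A_pow:
  "phi_gen vertex1.A [^]\<^bsub>\<G> \<Gamma>\<^sub>2\<^esub> (i::int)
    = pc_gen \<Gamma>\<^sub>2 vertex2.A1 [^]\<^bsub>\<G> \<Gamma>\<^sub>2\<^esub> i \<otimes>\<^bsub>\<G> \<Gamma>\<^sub>2\<^esub> pc_gen \<Gamma>\<^sub>2 vertex2.A2 [^]\<^bsub>\<G> \<Gamma>\<^sub>2\<^esub> i"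
  using pc_gen_commute[OF simple_graph_\<Gamma>\<^sub>2] by (simp add: G2.int_pow_mult_distrib edge_\<Gamma>\<^sub>2)

lemma eval_delay:
  "eval_word (\<G> \<Gamma>\<^sub>2) (pc_gen \<Gamma>\<^sub>2) (delay i j w) =
    pc_gen \<Gamma>\<^sub>2 vertex2.A1 [^]\<^bsub>\<G> \<Gamma>\<^sub>2\<^esub> i \<otimes>\<^bsub>\<G> \<Gamma>\<^sub>2\<^esub>
      (pc_gen \<Gamma>\<^sub>2 vertex2.A2 [^]\<^bsub>\<G> \<Gamma>\<^sub>2\<^esub> j \<otimes>\<^bsub>\<G> \<Gamma>\<^sub>2\<^esub> eval_word (\<G> \<Gamma>\<^sub>2) phi_gen w)"
proof (induction i j w rule: delay.induct)
  case (1 i j)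
  then show ?case
    using eval_power_word_\<Gamma>\<^sub>2[of _ _ "[]"] by (simp add: eval_power_word_\<Gamma>\<^sub>2)
next
  case (2 i j s w)
  then show ?case
    by (simp add: G2.eval_word_Cons phi_gen_A_pow G2.int_pow_mult G2.m_assoc edge_\<Gamma>\<^sub>2
        pc_gen_\<Gamma>\<^sub>2_left_commute[of vertex2.A2 vertex2.A1] del: phi_gen.simps)
next
  case (3 i j s w)
  then show ?case
    by (simp add: G2.eval_word_Cons eval_power_word_\<Gamma>\<^sub>2 edge_\<Gamma>\<^sub>2
        pc_gen_\<Gamma>\<^sub>2_left_commute[of vertex2.A2 vertex2.B])
next
  case (4 i j s w)
  then show ?case
    \<comment> \<open>The power of a_2 is written in front of c, so the pending power of a_1 has to
      pass both.\<close>
    by (simp add: G2.eval_word_Cons eval_power_word_\<Gamma>\<^sub>2 edge_\<Gamma>\<^sub>2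
        pc_gen_\<Gamma>\<^sub>2_left_commute[of vertex2.A1 vertex2.C]
        pc_gen_\<Gamma>\<^sub>2_left_commute[of vertex2.A1 vertex2.A2])
next
  case (5 i j s w)
  then show ?case
    by (simp add: G2.eval_word_Cons edge_\<Gamma>\<^sub>2
        pc_gen_\<Gamma>\<^sub>2_left_commute[of _ vertex2.D])
next
  case (6 i j s w)
  then show ?case
    by (simp add: G2.eval_word_Cons edge_\<Gamma>\<^sub>2
        pc_gen_\<Gamma>\<^sub>2_left_commute[of _ vertex2.E])
qed

text \<open>The neighbours d and e of a commute with both a_1 and a_2; the other edges of
  \<open>\<Gamma>\<^sub>1\<close> are also edges of \<open>\<Gamma>\<^sub>2\<close>. This makes
  \<phi> well defined.\<close>

lemma phi_gen_commute:
  assumes "{x, y} \<in> snd \<Gamma>\<^sub>1"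
  shows "phi_gen x \<otimes>\<^bsub>\<G> \<Gamma>\<^sub>2\<^esub> phi_gen y = phi_gen y \<otimes>\<^bsub>\<G> \<Gamma>\<^sub>2\<^esub> phi_gen x"
proof -
  have gens: "pc_gen \<Gamma>\<^sub>2 u \<otimes>\<^bsub>\<G> \<Gamma>\<^sub>2\<^esub> pc_gen \<Gamma>\<^sub>2 v = pc_gen \<Gamma>\<^sub>2 v \<otimes>\<^bsub>\<G> \<Gamma>\<^sub>2\<^esub> pc_gen \<Gamma>\<^sub>2 u"
    if "{u, v} \<in> snd \<Gamma>\<^sub>2" for u v
    using pc_gen_commute[OF simple_graph_\<Gamma>\<^sub>2 that] .
  have A: "phi_gen vertex1.A \<otimes>\<^bsub>\<G> \<Gamma>\<^sub>2\<^esub> pc_gen \<Gamma>\<^sub>2 v = pc_gen \<Gamma>\<^sub>2 v \<otimes>\<^bsub>\<G> \<Gamma>\<^sub>2\<^esub> phi_gen vertex1.A"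
    if "{vertex2.A1, v} \<in> snd \<Gamma>\<^sub>2" "{vertex2.A2, v} \<in> snd \<Gamma>\<^sub>2" for v
    using gens[OF that(1)] gens[OF that(2)]
    by (simp add: G2.m_assoc) (simp add: G2.m_assoc[symmetric])
  have D: "phi_gen vertex1.A \<otimes>\<^bsub>\<G> \<Gamma>\<^sub>2\<^esub> phi_gen vertex1.D = phi_gen vertex1.D \<otimes>\<^bsub>\<G> \<Gamma>\<^sub>2\<^esub> phi_gen vertex1.A"
    and E: "phi_gen vertex1.A \<otimes>\<^bsub>\<G> \<Gamma>\<^sub>2\<^esub> phi_gen vertex1.E = phi_gen vertex1.E \<otimes>\<^bsub>\<G> \<Gamma>\<^sub>2\<^esub> phi_gen vertex1.A"
    using A by (simp_all add: edge_\<Gamma>\<^sub>2 del: phi_gen.simps(1))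
  show ?thesis
    using assms gens[of vertex2.B vertex2.E] gens[of vertex2.C vertex2.D]
      gens[of vertex2.D vertex2.E] D E
    by (cases x; cases y) (simp_all add: edge_\<Gamma>\<^sub>1 edge_\<Gamma>\<^sub>2)
qed

theorem lemma3p1:
  shows "\<exists>\<phi> \<in> mon (\<G> \<Gamma>\<^sub>1) (\<G> \<Gamma>\<^sub>2).
    \<phi> (pc_gen \<Gamma>\<^sub>1 vertex1.A) = pc_gen \<Gamma>\<^sub>2 vertex2.A1 \<otimes>\<^bsub>\<G> \<Gamma>\<^sub>2\<^esub> pc_gen \<Gamma>\<^sub>2 vertex2.A2 \<and>
    \<phi> (pc_gen \<Gamma>\<^sub>1 vertex1.B) = pc_gen \<Gamma>\<^sub>2 vertex2.B \<and>
    \<phi> (pc_gen \<Gamma>\<^sub>1 vertex1.C) = pc_gen \<Gamma>\<^sub>2 vertex2.C \<and>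
    \<phi> (pc_gen \<Gamma>\<^sub>1 vertex1.D) = pc_gen \<Gamma>\<^sub>2 vertex2.D \<and>
    \<phi> (pc_gen \<Gamma>\<^sub>1 vertex1.E) = pc_gen \<Gamma>\<^sub>2 vertex2.E"
proof -
  let ?cls = "pres_class UNIV (pc_relators \<Gamma>\<^sub>1)"
  have "eval_word (\<G> \<Gamma>\<^sub>2) phi_gen r = \<one>\<^bsub>\<G> \<Gamma>\<^sub>2\<^esub>" if r: "r \<in> pc_relators \<Gamma>\<^sub>1" for r
  proof -
    obtain x y where "r = commutator_word x y" "{x, y} \<in> snd \<Gamma>\<^sub>1"
      using r by (auto simp: pc_relators_def)
    then show ?thesis
      using phi_gen_commute[of x y] by (simp add: G2.eval_commutator_word)
  qed
  then obtain \<phi> where hom: "\<phi> \<in> hom (\<G> \<Gamma>\<^sub>1) (\<G> \<Gamma>\<^sub>2)"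
    and \<phi>: "\<And>w. \<phi> (?cls w) = eval_word (\<G> \<Gamma>\<^sub>2) phi_gen w"
    using G2.presented_group_universal[of phi_gen UNIV "pc_relators \<Gamma>\<^sub>1"]
    by (auto simp: pc_group_def[of \<Gamma>\<^sub>1])
  interpret group_hom "\<G> \<Gamma>\<^sub>1" "\<G> \<Gamma>\<^sub>2" \<phi>
    by (simp add: group_hom_def group_hom_axioms_def hom group_pc_group)
  have kernel: "g = \<one>\<^bsub>\<G> \<Gamma>\<^sub>1\<^esub>" if "g \<in> carrier (\<G> \<Gamma>\<^sub>1)" "\<phi> g = \<one>\<^bsub>\<G> \<Gamma>\<^sub>2\<^esub>" for g
  proof -
    obtain w where "g = ?cls w"
      using \<open>g \<in> carrier (\<G> \<Gamma>\<^sub>1)\<close> by (auto simp: pc_group_def carrier_presented_group)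
    moreover obtain v where v: "reduced (snd \<Gamma>\<^sub>1) v"
      "eval_word (\<G> \<Gamma>\<^sub>1) (pc_gen \<Gamma>\<^sub>1) w = eval_word (\<G> \<Gamma>\<^sub>1) (pc_gen \<Gamma>\<^sub>1) v"
      using ex_reduced[OF simple_graph_\<Gamma>\<^sub>1, of w] by auto
    ultimately have g: "g = ?cls v"
      using pc_class_eq_eval_word[of _ \<Gamma>\<^sub>1] by simp
    \<comment> \<open>With nothing pending at the start, \<open>delay 0 0 v\<close> represents the
      image of \<open>g\<close>.\<close>
    then have "eval_word (\<G> \<Gamma>\<^sub>2) (pc_gen \<Gamma>\<^sub>2) (delay 0 0 v) = \<one>\<^bsub>\<G> \<Gamma>\<^sub>2\<^esub>"
      using that(2) by (simp add: \<phi> eval_delay)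
    then have "pres_eq (fst \<Gamma>\<^sub>2) (pc_relators \<Gamma>\<^sub>2) (delay 0 0 v) []"
      using pc_class_eq_eval_word[of _ \<Gamma>\<^sub>2]
      by (subst pres_class_eq_iff[symmetric]) simp_all
    then have "delay 0 0 v = []"
      using reduced_nontrivial[OF simple_graph_\<Gamma>\<^sub>2 reduced_delay[OF v(1)]] by simp
    then have "v = []"
      using delay_eq_Nil[OF v(1)] by simp
    then show ?thesis
      using g by (simp add: pc_group_def one_presented_group)
  qed
  then have "\<phi> \<in> mon (\<G> \<Gamma>\<^sub>1) (\<G> \<Gamma>\<^sub>2)"
    by (simp add: mon_def hom inj_on_one_iff)
  moreover have "\<phi> (pc_gen \<Gamma>\<^sub>1 x) = phi_gen x" for x
    using \<phi>[of "[(x, True)]"] by (simp add: pc_gen_def pres_gen_def eval_word_def)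
  ultimately show ?thesis by (intro bexI[of _ \<phi>]) simp_all
qed

end
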